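(* Let $\delta_0>0$ be a constant with the following two properties: (i) every orientation preserving harmonic mapping $F$ in the unit disk $\mathbb{D}$ with $\|S_H(F)\|\le\delta_0$ is one-to-one in $\mathbb{D}$; (ii) every orientation preserving harmonic mapping $F$ in $\mathbb{D}$ with $\|S_H(F)\|\le\delta_0 t$ for some $t<1$ has a quasiconformal extension to $\mathbb{C}\cup\{\infty\}$. Let $f=h+\overline{g}$ be an orientation preserving harmonic mapping in $\mathbb{D}$ with dilatation $\omega=g'/h'$. If \[ \limsup_{|z|\to 1}|S_H(f)(z)|\,(1-|z|^2)^2<\delta_0, \] then $f$ has bounded valence in $\mathbb{D}$, that is, there exists a positive integer $N$ such that $f$ takes every value at most $N$ times in $\mathbb{D}$.
   Context: $\mathbb{D}=\{z\in\mathbb{C}:|z|<1\}$. A complex-valued harmonic function $f$ in $\mathbb{D}$ is written in its canonical representation $f=h+\overline{g}$, with $h,g$ analytic in $\mathbb{D}$ and $g(0)=0$. An orientation preserving harmonic mapping in $\mathbb{D}$ is a locally univalent harmonic function $f=h+\overline g$ whose Jacobian $J_f=|h'|^2-|g'|^2$ is positive throughout $\mathbb{D}$; then $h'$ has no zeros in $\mathbb{D}$ and the dilatation $\omega=g'/h'$ is analytic in $\mathbb{D}$ with $|\omega(z)|<1$ for all $z\in\mathbb{D}$. The harmonic Schwarzian derivative of $f$ is \[ S_H(f)=S(h)+\frac{\overline{\omega}}{1-|\omega|^2}\left(\frac{h''}{h'}\,\omega'-\omega''\right)-\frac32\left(\frac{\overline{\omega}\,\omega'}{1-|\omega|^2}\right)^2,\qquad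 S(h)=\left(\frac{h''}{h'}\right)'-\frac12\left(\frac{h''}{h'}\right)^2, \] and the harmonic Schwarzian norm is $\|S_H(f)\|=\sup_{z\in\mathbb{D}}|S_H(f)(z)|\,(1-|z|^2)^2$. It is a known theorem that a positive constant $\delta_0$ with properties (i) and (ii), independent of the mapping, exists; its sharp value is not known. "$f$ takes every value at most $N$ times in $\mathbb{D}$" means that $n(f,w)\le N$ for every $w\in\mathbb{C}$, where $n(f,w)$ is the number of points $z\in\mathbb{D}$ (counting multiplicities) with $f(z)=w$. *)

theory Defs
  imports "HOL-Complex_Analysis.Complex_Analysis" "HOL-Library.Extended_Nat"
begin

abbreviation unit_disk :: "complex set" where
  "unit_disk \<equiv> ball 0 1"


section \<open>Harmonic mappings of the unit disk\<close>

definition canonical_rep :: "(complex \<Rightarrow> complex) \<Rightarrow> (complex \<Rightarrow> complex) \<Rightarrow> (complex \<Rightarrow> complex) \<Rightarrow> bool" where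
  "canonical_rep f h g \<longleftrightarrow>
     h holomorphic_on unit_disk \<and> g holomorphic_on unit_disk \<and> g 0 = 0 \<and>
     (\<forall>z\<in>unit_disk. f z = h z + cnj (g z))"

definition locally_univalent_on :: "(complex \<Rightarrow> complex) \<Rightarrow> complex set \<Rightarrow> bool" where
  "locally_univalent_on f S \<longleftrightarrow> (\<forall>z\<in>S. \<exists>r>0. ball z r \<subseteq> S \<and> inj_on f (ball z r))"

(* The Jacobian of h + cnj g. *)
definition jacobian_H :: "(complex \<Rightarrow> complex) \<Rightarrow> (complex \<Rightarrow> complex) \<Rightarrow> complex \<Rightarrow> real" where
  "jacobian_H h g z = (cmod (deriv h z))\<^sup>2 - (cmod (deriv g z))\<^sup>2"

definition orientation_preserving_harmonic ::
    "(complex \<Rightarrow> complex) \<Rightarrow> (complex \<Rightarrow> complex) \<Rightarrow> (complex \<Rightarrow> complex) \<Rightarrow> bool" where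
  "orientation_preserving_harmonic f h g \<longleftrightarrow>
     canonical_rep f h g \<and> locally_univalent_on f unit_disk \<and>
     (\<forall>z\<in>unit_disk. jacobian_H h g z > 0)"

definition dilatation :: "(complex \<Rightarrow> complex) \<Rightarrow> (complex \<Rightarrow> complex) \<Rightarrow> complex \<Rightarrow> complex" where
  "dilatation h g z = deriv g z / deriv h z"


section \<open>The harmonic Schwarzian derivative\<close>

definition pre_schwarzian :: "(complex \<Rightarrow> complex) \<Rightarrow> complex \<Rightarrow> complex" where
  "pre_schwarzian h z = deriv (deriv h) z / deriv h z"

definition schwarzian :: "(complex \<Rightarrow> complex) \<Rightarrow> complex \<Rightarrow> complex" where
  "schwarzian h z = deriv (pre_schwarzian h) z - (pre_schwarzian h z)\<^sup>2 / 2"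

definition schwarzian_H :: "(complex \<Rightarrow> complex) \<Rightarrow> (complex \<Rightarrow> complex) \<Rightarrow> complex \<Rightarrow> complex" where
  "schwarzian_H h g z =
     (let \<omega> = dilatation h g;
          c = cnj (\<omega> z) / (1 - of_real ((cmod (\<omega> z))\<^sup>2))
      in schwarzian h z
         + c * (pre_schwarzian h z * deriv \<omega> z - deriv (deriv \<omega>) z)
         - 3 / 2 * (c * deriv \<omega> z)\<^sup>2)"

definition weighted_schwarzian_H :: "(complex \<Rightarrow> complex) \<Rightarrow> (complex \<Rightarrow> complex) \<Rightarrow> complex \<Rightarrow> real" where
  "weighted_schwarzian_H h g z = cmod (schwarzian_H h g z) * (1 - (cmod z)\<^sup>2)\<^sup>2"

(* Extended-real valued, since the supremum may be infinite. *)
definition schwarzian_norm_H :: "(complex \<Rightarrow> complex) \<Rightarrow> (complex \<Rightarrow> complex) \<Rightarrow> ereal" where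
  "schwarzian_norm_H h g = (SUP z\<in>unit_disk. ereal (weighted_schwarzian_H h g z))"

(* Approach to the unit circle from inside the disk, uniformly in the argument. *)
definition at_unit_circle :: "complex filter" where
  "at_unit_circle = filtercomap cmod (at_left 1)"


section \<open>Valence\<close>

(* The multiplicity of the value f z0 of an orientation preserving harmonic mapping
   f = h + cnj g is the order n of the first nonvanishing coefficient a_n, n > 0, of
   h(z) = a_0 + a_1 (z - z0) + ...; since |g'| < |h'|, g - g(z0) vanishes at z0 at
   least to that order. *)
definition multiplicity_H :: "(complex \<Rightarrow> complex) \<Rightarrow> complex \<Rightarrow> nat" where
  "multiplicity_H h z0 = (LEAST n. 0 < n \<and> (deriv ^^ n) h z0 \<noteq> 0)"

definition valence_H :: "(complex \<Rightarrow> complex) \<Rightarrow> (complex \<Rightarrow> complex) \<Rightarrow> complex \<Rightarrow> enat" where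
  "valence_H f h w =
     (let Z = {z \<in> unit_disk. f z = w}
      in if finite Z then enat (\<Sum>z\<in>Z. multiplicity_H h z) else \<infinity>)"


section \<open>Quasiconformal mappings\<close>

text \<open>The analytic definition (Ahlfors): a homeomorphism onto its image that is absolutely
  continuous on lines and satisfies a Beltrami inequality almost everywhere.\<close>

definition abs_cont_on_interval :: "real \<Rightarrow> real \<Rightarrow> (real \<Rightarrow> complex) \<Rightarrow> bool" where
  "abs_cont_on_interval a b u \<longleftrightarrow>
     (\<forall>\<epsilon>>0. \<exists>\<delta>>0. \<forall>(n::nat) (x::nat \<Rightarrow> real) (y::nat \<Rightarrow> real).
        (\<forall>i<n. a \<le> x i \<and> x i \<le> y i \<and> y i \<le> b) \<longrightarrow>
        disjoint_family_on (\<lambda>i. {x i<..<y i}) {..<n} \<longrightarrow>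
        (\<Sum>i<n. y i - x i) < \<delta> \<longrightarrow>
        (\<Sum>i<n. cmod (u (y i) - u (x i))) < \<epsilon>)"

definition ACL_on :: "complex set \<Rightarrow> (complex \<Rightarrow> complex) \<Rightarrow> bool" where
  "ACL_on S f \<longleftrightarrow>
     (\<forall>a b. cbox a b \<subseteq> S \<longrightarrow>
        (AE y in lebesgue. y \<in> {Im a..Im b} \<longrightarrow>
           abs_cont_on_interval (Re a) (Re b) (\<lambda>x. f (Complex x y))) \<and>
        (AE x in lebesgue. x \<in> {Re a..Re b} \<longrightarrow>
           abs_cont_on_interval (Im a) (Im b) (\<lambda>y. f (Complex x y))))"

(* The inequality |f_zbar| <= k |f_z|, where p and q are the partial derivatives of f
   in the directions 1 and i, f_z = (p - i q)/2 and f_zbar = (p + i q)/2. *)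
definition beltrami_ineq_at :: "real \<Rightarrow> (complex \<Rightarrow> complex) \<Rightarrow> complex \<Rightarrow> bool" where
  "beltrami_ineq_at k f z \<longleftrightarrow>
     (\<exists>p q. ((\<lambda>s. f (z + of_real s)) has_vector_derivative p) (at 0) \<and>
            ((\<lambda>s. f (z + \<i> * of_real s)) has_vector_derivative q) (at 0) \<and>
            cmod ((p + \<i> * q) / 2) \<le> k * cmod ((p - \<i> * q) / 2))"

definition quasiconformal_on :: "real \<Rightarrow> complex set \<Rightarrow> (complex \<Rightarrow> complex) \<Rightarrow> bool" where
  "quasiconformal_on k S f \<longleftrightarrow>
     open S \<and> (\<exists>f'. homeomorphism S (f ` S) f f') \<and> ACL_on S f \<and>
     (AE z in lebesgue. z \<in> S \<longrightarrow> beltrami_ineq_at k f z)"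

text \<open>The Riemann sphere is the one-point compactification of the plane, with \<open>None\<close> as the point
  at infinity and the two charts given by the identity and the inversion. Quasiconformality on the
  sphere is quasiconformality in all pairs of charts.\<close>

abbreviation riemann_sphere :: "complex option topology" where
  "riemann_sphere \<equiv> Alexandroff_compactification (euclidean :: complex topology)"

fun sphere_inversion :: "complex option \<Rightarrow> complex option" where
  "sphere_inversion None = Some 0"
| "sphere_inversion (Some z) = (if z = 0 then None else Some (1 / z))"

definition quasiconformal_sphere :: "(complex option \<Rightarrow> complex option) \<Rightarrow> bool" where
  "quasiconformal_sphere \<Phi> \<longleftrightarrow>
     homeomorphic_map riemann_sphere riemann_sphere \<Phi> \<and>
     (\<exists>k. 0 \<le> k \<and> k < 1 \<and>
        (\<forall>A\<in>{id, sphere_inversion}. \<forall>B\<in>{id, sphere_inversion}.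
           quasiconformal_on k {z. B (\<Phi> (A (Some z))) \<noteq> None} (\<lambda>z. the (B (\<Phi> (A (Some z)))))))"

definition has_quasiconformal_extension :: "(complex \<Rightarrow> complex) \<Rightarrow> bool" where
  "has_quasiconformal_extension f \<longleftrightarrow>
     (\<exists>\<Phi>. quasiconformal_sphere \<Phi> \<and> (\<forall>z\<in>unit_disk. \<Phi> (Some z) = Some (f z)))"

end

theory Submission
  imports Defs
begin

text \<open>Choose \<open>\<beta> < \<delta>\<^sub>0\<close> above the upper limit, so that \<open>|S\<^sub>H(f)(z)| (1 - |z|\<^sup>2)\<^sup>2 < \<beta>\<close> on an annulus
\<open>r < |z| < 1\<close>. The aim is to show that \<open>f\<close> is injective near each boundary point \<open>\<zeta>\<close>, that is, on the
intersection of the unit disk with a disk around \<open>\<zeta>\<close>. Since \<open>f\<close> is locally injective in the open disk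
anyway, finitely many sets of injectivity then cover it by compactness of the closed disk, and their
number bounds the valence (\<open>bounded_valence_of_local_injectivity\<close>).

For injectivity near \<open>\<zeta>\<close>, let \<open>\<phi>\<close> map the disk conformally onto a lune contained in the annulus that
has an arc of the unit circle around \<open>\<zeta>\<close> on its boundary and whose interior angle \<open>a \<pi>\<close> is close to \<open>\<pi>\<close>
(\<open>boundary_chart\<close>). Up to linear fractional maps, which have vanishing Schwarzian, \<open>\<phi>\<close> is the power
\<open>w\<^sup>a\<close> on a half-plane, so its Schwarzian norm is at most \<open>2 (1 - a\<^sup>2)\<close>, which may be taken below
\<open>\<delta>\<^sub>0 - \<beta>\<close>. The composition rule
\<open>S\<^sub>H(f \<circ> \<phi>) = (S\<^sub>H(f) \<circ> \<phi>) (\<phi>')\<^sup>2 + S(\<phi>)\<close> (\<open>schwarzian_H_compose\<close>) and the Schwarz-Pick inequality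
\<open>|\<phi>'(z)| (1 - |z|\<^sup>2) \<le> 1 - |\<phi>(z)|\<^sup>2\<close> show that \<open>f \<circ> \<phi>\<close> has Schwarzian norm at most
\<open>\<beta> + (\<delta>\<^sub>0 - \<beta>) = \<delta>\<^sub>0\<close>, so it is injective by the univalence criterion, and \<open>f\<close> is injective on
the lune.\<close>

section \<open>The Schwarzian of a composition\<close>

lemma deriv_compose_on:
  assumes "open A" "open B" "\<phi> holomorphic_on A" "\<phi> ` A \<subseteq> B" "h holomorphic_on B" "z \<in> A"
  shows "deriv (\<lambda>w. h (\<phi> w)) z = deriv h (\<phi> z) * deriv \<phi> z"
    and "((\<lambda>w. h (\<phi> w)) has_field_derivative deriv h (\<phi> z) * deriv \<phi> z) (at z)"
proof -
  show *: "((\<lambda>w. h (\<phi> w)) has_field_derivative deriv h (\<phi> z) * deriv \<phi> z) (at z)"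
    using assms by (intro DERIV_chain2[where f = h]) (auto intro!: holomorphic_derivI)
  from DERIV_imp_deriv[OF this] show "deriv (\<lambda>w. h (\<phi> w)) z = deriv h (\<phi> z) * deriv \<phi> z" .
qed

lemma deriv_cong_open:
  assumes "open A" "z \<in> A" "\<And>w. w \<in> A \<Longrightarrow> u w = v w"
  shows "deriv u z = deriv v z"
  using assms by (intro deriv_cong_ev) (auto simp: eventually_nhds)

text \<open>Reads off a Schwarzian from closed formulas: \<open>u1\<close> is the derivative of \<open>u\<close> and \<open>p\<close> its
logarithmic derivative. The formulas are needed on a neighbourhood because the pre-Schwarzian is
differentiated once more.\<close>
lemma schwarzian_eqI:
  assumes "open S" "z \<in> S"
    and u: "\<And>w. w \<in> S \<Longrightarrow> (u has_field_derivative u1 w) (at w)"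
    and u1: "\<And>w. w \<in> S \<Longrightarrow> (u1 has_field_derivative p w * u1 w) (at w)"
    and nz: "\<And>w. w \<in> S \<Longrightarrow> u1 w \<noteq> 0"
    and p: "(p has_field_derivative q) (at z)"
  shows "schwarzian u z = q - (p z)\<^sup>2 / 2"
proof -
  have d1: "deriv u w = u1 w" if "w \<in> S" for w
    using u[OF that] by (rule DERIV_imp_deriv)
  have d2: "deriv (deriv u) w = p w * u1 w" if "w \<in> S" for w
    using deriv_cong_open[OF \<open>open S\<close> that d1] DERIV_imp_deriv[OF u1[OF that]] by simp
  have pre: "pre_schwarzian u w = p w" if "w \<in> S" for w
    using d1 d2 nz that by (simp add: pre_schwarzian_def)
  have "deriv (pre_schwarzian u) z = q"
    using deriv_cong_open[OF assms(1,2) pre] DERIV_imp_deriv[OF p] by simp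
  then show ?thesis
    using pre \<open>z \<in> S\<close> by (simp add: schwarzian_def)
qed

lemma pre_schwarzian_compose:
  assumes AB: "open A" "open B" and \<phi>: "\<phi> holomorphic_on A" "\<phi> ` A \<subseteq> B"
    and h: "h holomorphic_on B"
    and nz: "\<And>w. w \<in> B \<Longrightarrow> deriv h w \<noteq> 0" "\<And>w. w \<in> A \<Longrightarrow> deriv \<phi> w \<noteq> 0"
    and z: "z \<in> A"
  shows "pre_schwarzian (\<lambda>w. h (\<phi> w)) z = pre_schwarzian h (\<phi> z) * deriv \<phi> z + pre_schwarzian \<phi> z"
proof -
  have h': "deriv h holomorphic_on B" and \<phi>': "deriv \<phi> holomorphic_on A"
    using AB \<phi>(1) h by (auto intro: holomorphic_deriv)
  have "((\<lambda>w. deriv h (\<phi> w) * deriv \<phi> w) has_field_derivative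
      deriv (deriv h) (\<phi> z) * deriv \<phi> z * deriv \<phi> z + deriv (deriv \<phi>) z * deriv h (\<phi> z)) (at z)"
    by (intro DERIV_mult deriv_compose_on(2)[OF AB \<phi> h' z] holomorphic_derivI[OF \<phi>' AB(1) z])
  moreover have "deriv (deriv (\<lambda>w. h (\<phi> w))) z = deriv (\<lambda>w. deriv h (\<phi> w) * deriv \<phi> w) z"
    by (rule deriv_cong_open[OF AB(1) z deriv_compose_on(1)[OF AB \<phi> h]])
  ultimately have "deriv (deriv (\<lambda>w. h (\<phi> w))) z
      = deriv (deriv h) (\<phi> z) * deriv \<phi> z * deriv \<phi> z + deriv (deriv \<phi>) z * deriv h (\<phi> z)"
    by (simp add: DERIV_imp_deriv)
  moreover have "deriv h (\<phi> z) \<noteq> 0" "deriv \<phi> z \<noteq> 0"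
    using nz \<phi>(2) z by auto
  ultimately show ?thesis
    by (simp add: pre_schwarzian_def deriv_compose_on(1)[OF AB \<phi> h z] field_simps)
qed

lemma pre_schwarzian_holomorphic:
  assumes "open A" "h holomorphic_on A" "\<And>w. w \<in> A \<Longrightarrow> deriv h w \<noteq> 0"
  shows "pre_schwarzian h holomorphic_on A"
  unfolding pre_schwarzian_def[abs_def]
  using assms by (intro holomorphic_intros) auto

text \<open>The cocycle identity of the Schwarzian. Since \<open>\<phi>'' = P\<^sub>\<phi> \<phi>'\<close> for the pre-Schwarzian \<open>P\<^sub>\<phi>\<close>, the mixed
term of the squared pre-Schwarzian of the composition cancels the derivative of the factor \<open>\<phi>'\<close>.\<close>
lemma schwarzian_compose:
  assumes AB: "open A" "open B" and \<phi>: "\<phi> holomorphic_on A" "\<phi> ` A \<subseteq> B"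
    and h: "h holomorphic_on B"
    and nz: "\<And>w. w \<in> B \<Longrightarrow> deriv h w \<noteq> 0" "\<And>w. w \<in> A \<Longrightarrow> deriv \<phi> w \<noteq> 0"
    and z: "z \<in> A"
  shows "schwarzian (\<lambda>w. h (\<phi> w)) z = schwarzian h (\<phi> z) * (deriv \<phi> z)\<^sup>2 + schwarzian \<phi> z"
proof -
  note Ph = pre_schwarzian_holomorphic[OF AB(2) h nz(1)]
  note P\<phi> = pre_schwarzian_holomorphic[OF AB(1) \<phi>(1) nz(2)]
  have \<phi>': "deriv \<phi> holomorphic_on A"
    using AB \<phi>(1) by (auto intro: holomorphic_deriv)
  have "((\<lambda>w. pre_schwarzian h (\<phi> w) * deriv \<phi> w + pre_schwarzian \<phi> w) has_field_derivative
      deriv (pre_schwarzian h) (\<phi> z) * deriv \<phi> z * deriv \<phi> z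
      + deriv (deriv \<phi>) z * pre_schwarzian h (\<phi> z) + deriv (pre_schwarzian \<phi>) z) (at z)"
    by (intro DERIV_add DERIV_mult deriv_compose_on(2)[OF AB \<phi> Ph z]
        holomorphic_derivI[OF \<phi>' AB(1) z] holomorphic_derivI[OF P\<phi> AB(1) z])
  moreover have "deriv (pre_schwarzian (\<lambda>w. h (\<phi> w))) z
      = deriv (\<lambda>w. pre_schwarzian h (\<phi> w) * deriv \<phi> w + pre_schwarzian \<phi> w) z"
    by (rule deriv_cong_open[OF AB(1) z pre_schwarzian_compose[OF AB \<phi> h nz]])
  ultimately have "deriv (pre_schwarzian (\<lambda>w. h (\<phi> w))) z
      = deriv (pre_schwarzian h) (\<phi> z) * deriv \<phi> z * deriv \<phi> z
        + deriv (deriv \<phi>) z * pre_schwarzian h (\<phi> z) + deriv (pre_schwarzian \<phi>) z"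
    by (simp add: DERIV_imp_deriv)
  moreover have "deriv (deriv \<phi>) z = pre_schwarzian \<phi> z * deriv \<phi> z"
    using nz(2) z by (simp add: pre_schwarzian_def)
  ultimately show ?thesis
    using pre_schwarzian_compose[OF AB \<phi> h nz z]
    by (simp add: schwarzian_def field_simps power2_eq_square)
qed

text \<open>The same identity for harmonic mappings. The dilatation of \<open>f \<circ> \<phi>\<close> is \<open>\<omega> \<circ> \<phi>\<close>, so \<open>\<omega>'\<close> transforms as
a linear differential and \<open>(h'' / h') \<omega>' - \<omega>''\<close> as a quadratic one. The constant \<open>c\<close> allows for
the normalisation \<open>g 0 = 0\<close> of a canonical representation.\<close>
lemma schwarzian_H_compose:
  assumes AB: "open A" "open B" and \<phi>: "\<phi> holomorphic_on A" "\<phi> ` A \<subseteq> B"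
    and h: "h holomorphic_on B" and g: "g holomorphic_on B"
    and nz: "\<And>w. w \<in> B \<Longrightarrow> deriv h w \<noteq> 0" "\<And>w. w \<in> A \<Longrightarrow> deriv \<phi> w \<noteq> 0"
    and z: "z \<in> A"
  shows "schwarzian_H (\<lambda>w. h (\<phi> w)) (\<lambda>w. g (\<phi> w) - c) z
    = schwarzian_H h g (\<phi> z) * (deriv \<phi> z)\<^sup>2 + schwarzian \<phi> z"
proof -
  define \<omega> where "\<omega> = dilatation h g"
  define \<Omega> where "\<Omega> = dilatation (\<lambda>w. h (\<phi> w)) (\<lambda>w. g (\<phi> w) - c)"
  have h': "deriv h holomorphic_on B" and g': "deriv g holomorphic_on B"
    and \<phi>': "deriv \<phi> holomorphic_on A"
    using AB \<phi>(1) h g by (auto intro: holomorphic_deriv)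
  have \<omega>: "\<omega> holomorphic_on B"
    unfolding \<omega>_def dilatation_def[abs_def] by (intro holomorphic_on_divide h' g' nz)
  have \<omega>': "deriv \<omega> holomorphic_on B"
    using AB \<omega> by (auto intro: holomorphic_deriv)
  have dG: "deriv (\<lambda>w. g (\<phi> w) - c) w = deriv g (\<phi> w) * deriv \<phi> w" if "w \<in> A" for w
    using DERIV_diff[OF deriv_compose_on(2)[OF AB \<phi> g that] DERIV_const[of c]]
    by (simp add: DERIV_imp_deriv)
  have \<Omega>0: "\<Omega> w = \<omega> (\<phi> w)" if "w \<in> A" for w
    using nz(2)[OF that]
    by (simp add: \<Omega>_def \<omega>_def dilatation_def dG that deriv_compose_on(1)[OF AB \<phi> h that])
  have \<Omega>1: "deriv \<Omega> w = deriv \<omega> (\<phi> w) * deriv \<phi> w" if "w \<in> A" for w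
    using deriv_cong_open[OF AB(1) that \<Omega>0] deriv_compose_on(1)[OF AB \<phi> \<omega> that] by simp
  have "((\<lambda>w. deriv \<omega> (\<phi> w) * deriv \<phi> w) has_field_derivative
      deriv (deriv \<omega>) (\<phi> z) * deriv \<phi> z * deriv \<phi> z + deriv (deriv \<phi>) z * deriv \<omega> (\<phi> z)) (at z)"
    by (intro DERIV_mult deriv_compose_on(2)[OF AB \<phi> \<omega>' z] holomorphic_derivI[OF \<phi>' AB(1) z])
  moreover have "deriv (deriv \<Omega>) z = deriv (\<lambda>w. deriv \<omega> (\<phi> w) * deriv \<phi> w) z"
    by (rule deriv_cong_open[OF AB(1) z \<Omega>1])
  ultimately have \<Omega>2: "deriv (deriv \<Omega>) z
      = deriv (deriv \<omega>) (\<phi> z) * deriv \<phi> z * deriv \<phi> z + deriv (deriv \<phi>) z * deriv \<omega> (\<phi> z)"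
    by (simp add: DERIV_imp_deriv)
  have "deriv (deriv \<phi>) z = pre_schwarzian \<phi> z * deriv \<phi> z"
    using nz(2) z by (simp add: pre_schwarzian_def)
  (* The second derivative of the inner map cancels, so this factor is a quadratic differential. *)
  then have quad: "pre_schwarzian (\<lambda>w. h (\<phi> w)) z * deriv \<Omega> z - deriv (deriv \<Omega>) z
      = (pre_schwarzian h (\<phi> z) * deriv \<omega> (\<phi> z) - deriv (deriv \<omega>) (\<phi> z)) * (deriv \<phi> z)\<^sup>2"
    using pre_schwarzian_compose[OF AB \<phi> h nz z]
    by (simp add: \<Omega>1[OF z] \<Omega>2 algebra_simps power2_eq_square)
  define k where "k = cnj (\<omega> (\<phi> z)) / (1 - of_real ((cmod (\<omega> (\<phi> z)))\<^sup>2))"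
  have "schwarzian_H (\<lambda>w. h (\<phi> w)) (\<lambda>w. g (\<phi> w) - c) z = schwarzian (\<lambda>w. h (\<phi> w)) z
      + k * (pre_schwarzian (\<lambda>w. h (\<phi> w)) z * deriv \<Omega> z - deriv (deriv \<Omega>) z)
      - 3 / 2 * (k * deriv \<Omega> z)\<^sup>2"
    by (simp add: schwarzian_H_def Let_def k_def \<Omega>0[OF z] flip: \<Omega>_def)
  also have "\<dots> = (schwarzian h (\<phi> z)
      + k * (pre_schwarzian h (\<phi> z) * deriv \<omega> (\<phi> z) - deriv (deriv \<omega>) (\<phi> z))
      - 3 / 2 * (k * deriv \<omega> (\<phi> z))\<^sup>2) * (deriv \<phi> z)\<^sup>2 + schwarzian \<phi> z"
    unfolding quad using schwarzian_compose[OF AB \<phi> h nz z]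
    by (simp add: \<Omega>1[OF z] algebra_simps power_mult_distrib)
  also have "\<dots> = schwarzian_H h g (\<phi> z) * (deriv \<phi> z)\<^sup>2 + schwarzian \<phi> z"
    by (simp add: schwarzian_H_def Let_def k_def flip: \<omega>_def)
  finally show ?thesis .
qed

section \<open>The Schwarz-Pick inequality\<close>

text \<open>Conjugating by disk automorphisms that move \<open>z\<close> and \<open>\<phi> z\<close> to the origin reduces the claim to the
Schwarz lemma. This is what makes the weight \<open>(1 - |z|\<^sup>2)\<^sup>2\<close> behave well under composition with
arbitrary self-maps of the disk.\<close>
lemma schwarz_pick:
  assumes hol: "\<phi> holomorphic_on unit_disk" and maps: "\<phi> ` unit_disk \<subseteq> unit_disk"
    and z: "z \<in> unit_disk"
  shows "cmod (deriv \<phi> z) * (1 - (cmod z)\<^sup>2) \<le> 1 - (cmod (\<phi> z))\<^sup>2"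
proof -
  define w where "w = \<phi> z"
  have zw: "cmod z < 1" "cmod w < 1"
    using z maps by (auto simp: w_def image_subset_iff)
  define F where "F = (\<lambda>u. Moebius_function 0 w (\<phi> (Moebius_function 0 (-z) u)))"
  have Mz: "Moebius_function 0 (-z) 0 = z"
    by (simp add: Moebius_function_def)
  have Mz_maps: "Moebius_function 0 (-z) ` unit_disk \<subseteq> unit_disk"
    using zw by (auto intro!: Moebius_function_norm_lt_1)
  have \<phi>Mz: "(\<lambda>u. \<phi> (Moebius_function 0 (-z) u)) holomorphic_on unit_disk"
    using holomorphic_on_compose_gen[OF Moebius_function_holomorphic hol Mz_maps] zw
    by (simp add: o_def)
  have "F holomorphic_on unit_disk"
    unfolding F_def
    using holomorphic_on_compose_gen[OF \<phi>Mz Moebius_function_holomorphic[of w 0]] zw Mz_maps maps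
    by (auto simp: o_def image_subset_iff)
  moreover have "F 0 = 0"
    by (simp add: F_def Mz w_def Moebius_function_eq_zero)
  moreover have "cmod (F u) < 1" if "cmod u < 1" for u
  proof -
    have "Moebius_function 0 (-z) u \<in> unit_disk"
      using Mz_maps that by (auto simp: image_subset_iff)
    with maps have "cmod (\<phi> (Moebius_function 0 (-z) u)) < 1"
      by (auto simp: image_subset_iff)
    with zw(2) show ?thesis
      unfolding F_def by (rule Moebius_function_norm_lt_1)
  qed
  ultimately have F': "cmod (deriv F 0) \<le> 1"
    using Schwarz_Lemma(2)[of F 0] by simp
  have sq: "1 - cnj v * v = of_real (1 - (cmod v)\<^sup>2)" for v
    unfolding of_real_diff of_real_1 complex_norm_square by (simp add: mult.commute)
  have nz: "1 - (cmod z)\<^sup>2 > 0" "1 - (cmod w)\<^sup>2 > 0"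
    using zw by (simp_all add: power_less_one_iff)
  have nz': "1 - cnj w * w \<noteq> 0"
    using nz unfolding sq of_real_eq_0_iff by simp
  have d1: "(Moebius_function 0 (-z) has_field_derivative of_real (1 - (cmod z)\<^sup>2)) (at 0)"
    unfolding Moebius_function_simple[abs_def]
    using sq[of z] by (auto intro!: derivative_eq_intros simp: mult.commute)
  have d2: "(Moebius_function 0 w has_field_derivative 1 / of_real (1 - (cmod w)\<^sup>2)) (at w)"
    unfolding Moebius_function_simple[abs_def] using nz' unfolding sq[symmetric]
    by (auto intro!: derivative_eq_intros simp: divide_simps)
  have d\<phi>: "(\<phi> has_field_derivative deriv \<phi> z) (at z)"
    using hol z by (auto intro: holomorphic_derivI)
  have "(F has_field_derivative
      1 / of_real (1 - (cmod w)\<^sup>2) * (deriv \<phi> z * of_real (1 - (cmod z)\<^sup>2))) (at 0)"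
    unfolding F_def
  proof (rule DERIV_chain2[where f = "Moebius_function 0 w"])
    show "(Moebius_function 0 w has_field_derivative 1 / of_real (1 - (cmod w)\<^sup>2))
        (at (\<phi> (Moebius_function 0 (-z) 0)))"
      using d2 by (simp only: Mz w_def)
    show "((\<lambda>u. \<phi> (Moebius_function 0 (-z) u)) has_field_derivative
        deriv \<phi> z * of_real (1 - (cmod z)\<^sup>2)) (at 0)"
      using d\<phi> by (intro DERIV_chain2[where f = \<phi>] d1) (simp only: Mz)
  qed
  then have "cmod (deriv F 0) = cmod (deriv \<phi> z) * (1 - (cmod z)\<^sup>2) / (1 - (cmod w)\<^sup>2)"
    using nz by (simp only: DERIV_imp_deriv norm_mult norm_divide norm_one norm_of_real abs_of_pos) simp
  with F' nz show ?thesis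
    by (simp add: w_def divide_simps)
qed

section \<open>Linear fractional maps\<close>

definition linear_fractional :: "complex \<Rightarrow> complex \<Rightarrow> complex \<Rightarrow> complex \<Rightarrow> complex \<Rightarrow> complex" where
  "linear_fractional a b c d w = (a * w + b) / (c * w + d)"

lemma linear_fractional_derivative:
  assumes "c * w + d \<noteq> 0"
  shows "(linear_fractional a b c d has_field_derivative (a * d - b * c) / (c * w + d)\<^sup>2) (at w)"
  unfolding linear_fractional_def[abs_def] using assms
  by (auto intro!: derivative_eq_intros simp: field_simps power2_eq_square)

lemma open_linear_fractional_domain: "open {w::complex. c * w + d \<noteq> 0}"
  by (intro open_Collect_neq continuous_intros)

lemma linear_fractional_holomorphic: "linear_fractional a b c d holomorphic_on {w. c * w + d \<noteq> 0}"
  unfolding linear_fractional_def[abs_def] by (intro holomorphic_intros) auto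

lemma linear_fractional_eq_iff:
  assumes "a * d - b * c \<noteq> 0" "c * x + d \<noteq> 0" "c * y + d \<noteq> 0"
  shows "linear_fractional a b c d x = linear_fractional a b c d y \<longleftrightarrow> x = y"
proof
  assume "linear_fractional a b c d x = linear_fractional a b c d y"
  with assms(2,3) have "(a * x + b) * (c * y + d) = (a * y + b) * (c * x + d)"
    by (simp add: linear_fractional_def frac_eq_eq)
  then have "(a * d - b * c) * (x - y) = 0"
    by (simp add: algebra_simps)
  with assms(1) show "x = y"
    by simp
qed auto

lemma linear_fractional_compose_holomorphic:
  assumes "q holomorphic_on A" "\<And>w. w \<in> A \<Longrightarrow> c * q w + d \<noteq> 0"
  shows "(\<lambda>w. linear_fractional a b c d (q w)) holomorphic_on A"
  unfolding linear_fractional_def using assms by (intro holomorphic_intros)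

lemma linear_fractional_compose_inj:
  assumes "a * d - b * c \<noteq> 0" "inj_on q A" "\<And>w. w \<in> A \<Longrightarrow> c * q w + d \<noteq> 0"
  shows "inj_on (\<lambda>w. linear_fractional a b c d (q w)) A"
  using assms linear_fractional_eq_iff[OF assms(1)] unfolding inj_on_def by blast

lemma schwarzian_linear_fractional:
  assumes det: "a * d - b * c \<noteq> 0" and w: "c * w + d \<noteq> 0"
  shows "schwarzian (linear_fractional a b c d) w = 0"
proof -
  have "schwarzian (linear_fractional a b c d) w = 2 * c\<^sup>2 / (c * w + d)\<^sup>2 - (- 2 * c / (c * w + d))\<^sup>2 / 2"
  proof (rule schwarzian_eqI[OF open_linear_fractional_domain])
    show "w \<in> {w. c * w + d \<noteq> 0}"
      using w by simp
    fix u assume "u \<in> {w. c * w + d \<noteq> 0}"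
    then have u: "c * u + d \<noteq> 0"
      by simp
    show "(linear_fractional a b c d has_field_derivative (a * d - b * c) / (c * u + d)\<^sup>2) (at u)"
      by (rule linear_fractional_derivative[OF u])
    show "(a * d - b * c) / (c * u + d)\<^sup>2 \<noteq> 0"
      using det u by simp
    show "((\<lambda>u. (a * d - b * c) / (c * u + d)\<^sup>2) has_field_derivative
        - 2 * c / (c * u + d) * ((a * d - b * c) / (c * u + d)\<^sup>2)) (at u)"
      using u by (auto intro!: derivative_eq_intros simp: divide_simps power2_eq_square)
  next
    show "((\<lambda>u. - 2 * c / (c * u + d)) has_field_derivative 2 * c\<^sup>2 / (c * w + d)\<^sup>2) (at w)"
      using w by (auto intro!: derivative_eq_intros simp: divide_simps power2_eq_square)
  qed
  then show ?thesis
    by (simp add: power_divide power_mult_distrib)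
qed

lemma schwarzian_linear_fractional_compose:
  assumes "open A" "q holomorphic_on A" "\<And>w. w \<in> A \<Longrightarrow> deriv q w \<noteq> 0" "z \<in> A"
    and det: "a * d - b * c \<noteq> 0" and dom: "\<And>w. w \<in> A \<Longrightarrow> c * q w + d \<noteq> 0"
  shows "schwarzian (\<lambda>w. linear_fractional a b c d (q w)) z = schwarzian q z"
proof -
  have "deriv (linear_fractional a b c d) w \<noteq> 0" if "w \<in> {w. c * w + d \<noteq> 0}" for w
    using DERIV_imp_deriv[OF linear_fractional_derivative[of c w d a b]] that det by simp
  then have "schwarzian (\<lambda>w. linear_fractional a b c d (q w)) z
      = schwarzian (linear_fractional a b c d) (q z) * (deriv q z)\<^sup>2 + schwarzian q z"
    using assms by (intro schwarzian_compose[OF _ open_linear_fractional_domain _ _ linear_fractional_holomorphic]) auto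
  then show ?thesis
    using schwarzian_linear_fractional[OF det dom] \<open>z \<in> A\<close> by simp
qed

section \<open>The power map onto a sector\<close>

definition half_plane :: "complex set" where
  "half_plane = {w. 0 < Re w}"

lemma open_half_plane: "open half_plane"
  unfolding half_plane_def by (rule open_halfspace_Re_gt)

lemma half_plane_Ln: "w \<in> half_plane \<Longrightarrow> w \<noteq> 0 \<and> w \<notin> \<real>\<^sub>\<le>\<^sub>0 \<and> \<bar>Im (Ln w)\<bar> < pi / 2"
  using Re_Ln_pos_lt[of w] by (cases "w = 0") (auto simp: half_plane_def complex_nonpos_Reals_iff)

text \<open>The power \<open>w\<^sup>a\<close>, rotated by \<open>(1 - a) \<pi> / 2\<close>. For \<open>0 < a < 1\<close> the right half-plane is mapped onto the
sector of opening \<open>a \<pi>\<close> inside it whose upper edge is the positive imaginary axis.\<close>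
definition wedge :: "real \<Rightarrow> complex \<Rightarrow> complex" where
  "wedge a w = exp (of_real a * Ln w + \<i> * of_real ((1 - a) * pi / 2))"

lemma wedge_derivative:
  assumes "w \<in> half_plane"
  shows "(wedge a has_field_derivative of_real a * wedge a w / w) (at w)"
  unfolding wedge_def[abs_def] using half_plane_Ln[OF assms]
  by (auto intro!: derivative_eq_intros simp: divide_simps)

lemma wedge_holomorphic: "wedge a holomorphic_on half_plane"
  using wedge_derivative open_half_plane by (auto simp: holomorphic_on_open)

lemma wedge_nonzero: "wedge a w \<noteq> 0"
  by (simp add: wedge_def)

lemma wedge_deriv_nonzero: "w \<in> half_plane \<Longrightarrow> a \<noteq> 0 \<Longrightarrow> deriv (wedge a) w \<noteq> 0"
  using DERIV_imp_deriv[OF wedge_derivative[of w a]] half_plane_Ln[of w] wedge_nonzero[of a w] by simp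

text \<open>As \<open>a\<close> tends to 1 the sector fills the half-plane, and the Schwarzian tends to zero relative to the
hyperbolic density. This smallness is the reason for choosing the opening close to \<open>\<pi>\<close>.\<close>
lemma schwarzian_wedge:
  assumes "w \<in> half_plane" "a \<noteq> 0"
  shows "schwarzian (wedge a) w = of_real (1 - a\<^sup>2) / (2 * w\<^sup>2)"
proof -
  have "schwarzian (wedge a) w = - (of_real a - 1) / w\<^sup>2 - ((of_real a - 1) / w)\<^sup>2 / 2"
  proof (rule schwarzian_eqI[OF open_half_plane assms(1)])
    fix u assume u: "u \<in> half_plane"
    show "(wedge a has_field_derivative of_real a * wedge a u / u) (at u)"
      by (rule wedge_derivative[OF u])
    show "((\<lambda>u. of_real a * wedge a u / u) has_field_derivative
        (of_real a - 1) / u * (of_real a * wedge a u / u)) (at u)"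
      using half_plane_Ln[OF u]
      by (auto intro!: derivative_eq_intros wedge_derivative[OF u] simp: divide_simps) (simp add: algebra_simps)
    show "of_real a * wedge a u / u \<noteq> 0"
      using half_plane_Ln[OF u] wedge_nonzero assms(2) by simp
  next
    show "((\<lambda>u. (of_real a - 1) / u) has_field_derivative - (of_real a - 1) / w\<^sup>2) (at w)"
      using half_plane_Ln[OF assms(1)]
      by (auto intro!: derivative_eq_intros simp: divide_simps power2_eq_square)
  qed
  then show ?thesis
    using half_plane_Ln[OF assms(1)] by (simp add: field_simps power2_eq_square)
qed

text \<open>The argument of \<open>wedge a w\<close> lies strictly between \<open>\<pi> / 2 - a \<pi>\<close> and \<open>\<pi> / 2\<close>. The second inequality
says that the sector keeps a positive angle from the negative imaginary axis.\<close>
lemma wedge_argument: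
  assumes a: "1 / 2 \<le> a" "a < 1" and w: "w \<in> half_plane"
  shows "0 < Re (wedge a w)" and "- Im (wedge a w) \<le> \<bar>cos (a * pi)\<bar> * cmod (wedge a w)"
proof -
  define \<eta> where "\<eta> = a * Im (Ln w) + (1 - a) * pi / 2"
  have "a * \<bar>Im (Ln w)\<bar> < a * (pi / 2)"
    using half_plane_Ln[OF w] a by (intro mult_strict_left_mono) auto
  then have im: "- (a * (pi / 2)) < a * Im (Ln w)" "a * Im (Ln w) < a * (pi / 2)"
    using a abs_ge_self[of "a * Im (Ln w)"] abs_ge_minus_self[of "a * Im (Ln w)"]
    by (simp_all only: abs_mult abs_of_pos)
  then have \<eta>: "pi / 2 - a * pi < \<eta>" "\<eta> < pi / 2"
    by (simp_all add: \<eta>_def field_simps)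
  have "a * pi < 1 * pi"
    using a by (intro mult_strict_right_mono) auto
  then have \<eta>': "- (pi / 2) < pi / 2 - a * pi"
    by simp
  have Im: "Im (of_real a * Ln w + \<i> * of_real ((1 - a) * pi / 2)) = \<eta>"
    by (simp add: \<eta>_def)
  have n: "cmod (wedge a w) = exp (Re (of_real a * Ln w + \<i> * of_real ((1 - a) * pi / 2)))"
    by (simp add: wedge_def norm_exp_eq_Re)
  have re: "Re (wedge a w) = cmod (wedge a w) * cos \<eta>"
    unfolding n unfolding wedge_def Re_exp Im ..
  have ima: "Im (wedge a w) = cmod (wedge a w) * sin \<eta>"
    unfolding n unfolding wedge_def Im_exp Im ..
  have pos: "cmod (wedge a w) > 0"
    by (simp add: wedge_nonzero)
  have "cos \<eta> > 0"
    using \<eta> \<eta>' by (intro cos_gt_zero_pi) linarith+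
  with re pos show "0 < Re (wedge a w)"
    by simp
  have "sin (pi / 2 - a * pi) \<le> sin \<eta>"
    using \<eta> \<eta>' by (subst sin_mono_le_eq) linarith+
  then have "cos (a * pi) \<le> sin \<eta>"
    by (simp add: sin_cos_eq)
  then have "- sin \<eta> * cmod (wedge a w) \<le> \<bar>cos (a * pi)\<bar> * cmod (wedge a w)"
    using pos by (intro mult_right_mono) auto
  then show "- Im (wedge a w) \<le> \<bar>cos (a * pi)\<bar> * cmod (wedge a w)"
    by (simp add: ima mult.commute)
qed

lemma wedge_inj:
  assumes "0 < a" "a < 1"
  shows "inj_on (wedge a) half_plane"
proof (rule inj_onI)
  fix x y assume xy: "x \<in> half_plane" "y \<in> half_plane" "wedge a x = wedge a y"
  have "exp (of_real a * Ln x) = exp (of_real a * Ln y)"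
    using xy(3) by (simp add: wedge_def exp_add)
  moreover have "- pi < Im (of_real a * Ln u)" "Im (of_real a * Ln u) \<le> pi" if "u \<in> half_plane" for u
  proof -
    have "a * \<bar>Im (Ln u)\<bar> \<le> 1 * (pi / 2)"
      using assms half_plane_Ln[OF that] by (intro mult_mono) auto
    then have "\<bar>a * Im (Ln u)\<bar> < pi"
      using assms pi_gt_zero by (simp only: abs_mult abs_of_pos)
    then show "- pi < Im (of_real a * Ln u)" "Im (of_real a * Ln u) \<le> pi"
      by (auto simp: abs_if split: if_splits)
  qed
  ultimately have "of_real a * Ln x = of_real a * Ln y"
    using xy(1,2) Ln_exp by metis
  with assms have "Ln x = Ln y"
    by simp
  then show "x = y"
    using xy half_plane_Ln by (metis exp_Ln)
qed

text \<open>For \<open>a \<ge> 1 / 2\<close> the sector contains the open first quadrant, hence the part of the half-plane near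
any point of the positive imaginary axis.\<close>
lemma wedge_covers_quadrant:
  assumes a: "1 / 2 \<le> a" "a < 1" and w: "0 < Re w" "0 < Im w"
  shows "\<exists>u\<in>half_plane. wedge a u = w"
proof -
  define \<mu> where "\<mu> = (Ln w - \<i> * of_real ((1 - a) * pi / 2)) / of_real a"
  have w0: "w \<noteq> 0"
    using w by auto
  have Lw: "0 < Im (Ln w)" "Im (Ln w) < pi / 2"
    using Im_Ln_pos_lt[OF w0] Re_Ln_pos_lt[OF w0] w Im_Ln_pos_lt_imp[of w] by auto
  have Im: "Im \<mu> = (Im (Ln w) - (1 - a) * pi / 2) / a"
    by (simp add: \<mu>_def)
  have "Im (Ln w) - (1 - a) * pi / 2 < a * (pi / 2)"
    using Lw by (simp add: field_simps)
  then have up: "Im \<mu> < pi / 2"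
    using a by (simp add: Im field_simps)
  have "(1 - a) * (pi / 2) \<le> a * (pi / 2)"
    using a by (intro mult_right_mono) auto
  then have "- (a * (pi / 2)) < Im (Ln w) - (1 - a) * pi / 2"
    using Lw by linarith
  then have lo: "- (pi / 2) < Im \<mu>"
    using a by (simp add: Im field_simps)
  have "exp \<mu> \<in> half_plane"
    using lo up cos_gt_zero_pi[of "Im \<mu>"] by (simp add: half_plane_def Re_exp)
  moreover have "Ln (exp \<mu>) = \<mu>"
    using lo up pi_gt_zero by (intro Ln_exp) linarith+
  then have "wedge a (exp \<mu>) = w"
    using a w0 by (simp add: wedge_def \<mu>_def)
  ultimately show ?thesis
    by blast
qed

section \<open>Lunes resting on the unit circle\<close>

text \<open>The Cayley transform \<open>(1 + z) / (1 - z)\<close> is a hyperbolic isometry of the disk onto the right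
half-plane, which is the content of the last equation.\<close>
lemma cayley_properties:
  assumes "z \<in> unit_disk"
  shows "- 1 * z + 1 \<noteq> 0" "linear_fractional 1 1 (-1) 1 z \<in> half_plane"
    and "cmod (deriv (linear_fractional 1 1 (-1) 1) z) * (1 - (cmod z)\<^sup>2) = 2 * Re (linear_fractional 1 1 (-1) 1 z)"
proof -
  show z1: "- 1 * z + 1 \<noteq> 0"
    using assms by auto
  then have n: "(cmod (1 - z))\<^sup>2 > 0"
    by auto
  have Re: "Re (linear_fractional 1 1 (-1) 1 z) = (1 - (cmod z)\<^sup>2) / (cmod (1 - z))\<^sup>2"
    by (simp add: linear_fractional_def Re_divide cmod_power2) (simp add: power2_eq_square algebra_simps)
  moreover have "1 - (cmod z)\<^sup>2 > 0"
    using assms by (simp add: power_less_one_iff)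
  ultimately show "linear_fractional 1 1 (-1) 1 z \<in> half_plane"
    using n by (simp add: half_plane_def)
  have "deriv (linear_fractional 1 1 (-1) 1) z = 2 / (1 - z)\<^sup>2"
    using DERIV_imp_deriv[OF linear_fractional_derivative[OF z1, of 1 1]] by simp
  then show "cmod (deriv (linear_fractional 1 1 (-1) 1) z) * (1 - (cmod z)\<^sup>2) = 2 * Re (linear_fractional 1 1 (-1) 1 z)"
    by (simp add: Re norm_divide norm_power)
qed

definition wedge_disk :: "real \<Rightarrow> complex \<Rightarrow> complex" where
  "wedge_disk a z = wedge a (linear_fractional 1 1 (-1) 1 z)"

lemma wedge_disk_holomorphic: "wedge_disk a holomorphic_on unit_disk"
proof -
  have "linear_fractional 1 1 (-1) 1 holomorphic_on unit_disk"
    using cayley_properties(1) by (intro holomorphic_on_subset[OF linear_fractional_holomorphic]) auto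
  then have "wedge a \<circ> linear_fractional 1 1 (-1) 1 holomorphic_on unit_disk"
    using cayley_properties(2) by (intro holomorphic_on_compose_gen[OF _ wedge_holomorphic]) auto
  then show ?thesis
    by (simp add: wedge_disk_def[abs_def] o_def)
qed

lemma wedge_disk_inj:
  assumes "0 < a" "a < 1"
  shows "inj_on (wedge_disk a) unit_disk"
proof (rule inj_onI)
  fix x y assume xy: "x \<in> unit_disk" "y \<in> unit_disk" "wedge_disk a x = wedge_disk a y"
  then have "linear_fractional 1 1 (-1) 1 x = linear_fractional 1 1 (-1) 1 y"
    using wedge_inj[OF assms] cayley_properties(2) by (auto simp: wedge_disk_def inj_on_def)
  then show "x = y"
    using linear_fractional_eq_iff[OF _ cayley_properties(1)[OF xy(1)] cayley_properties(1)[OF xy(2)], of 1 1]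
    by simp
qed

lemma wedge_disk_deriv_nonzero:
  assumes "0 < a" "a < 1" "z \<in> unit_disk"
  shows "deriv (wedge_disk a) z \<noteq> 0"
  using holomorphic_injective_imp_regular[OF wedge_disk_holomorphic open_ball wedge_disk_inj] assms
  by blast

text \<open>The isometry property of the Cayley transform turns the weighted norm into
\<open>2 (1 - a\<^sup>2) (Re K / |K|)\<^sup>2\<close> with \<open>K\<close> the Cayley transform of \<open>z\<close>.\<close>
lemma schwarzian_wedge_disk:
  assumes a: "0 < a" "a < 1" and z: "z \<in> unit_disk"
  shows "cmod (schwarzian (wedge_disk a) z) * (1 - (cmod z)\<^sup>2)\<^sup>2 \<le> 2 * (1 - a\<^sup>2)"
proof -
  define K where "K = linear_fractional 1 1 (-1) 1"
  have K: "K z \<in> half_plane" "cmod (deriv K z) * (1 - (cmod z)\<^sup>2) = 2 * Re (K z)"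
    using cayley_properties[OF z] by (simp_all add: K_def)
  have "schwarzian (wedge_disk a) z = schwarzian (wedge a) (K z) * (deriv K z)\<^sup>2 + schwarzian K z"
    unfolding wedge_disk_def[abs_def] K_def[symmetric]
  proof (rule schwarzian_compose[OF open_ball open_half_plane _ _ wedge_holomorphic _ _ z])
    show "K holomorphic_on unit_disk"
      unfolding K_def using cayley_properties(1)
      by (intro holomorphic_on_subset[OF linear_fractional_holomorphic]) auto
    show "K ` unit_disk \<subseteq> half_plane"
      using cayley_properties(2) by (auto simp: K_def)
    show "deriv (wedge a) w \<noteq> 0" if "w \<in> half_plane" for w
      using wedge_deriv_nonzero[OF that] a by simp
    show "deriv K w \<noteq> 0" if "w \<in> unit_disk" for w
      using cayley_properties(2,3)[OF that] by (auto simp: K_def half_plane_def)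
  qed
  also have "schwarzian K z = 0"
    unfolding K_def by (rule schwarzian_linear_fractional[OF _ cayley_properties(1)[OF z]]) simp
  finally have "schwarzian (wedge_disk a) z = of_real (1 - a\<^sup>2) / (2 * (K z)\<^sup>2) * (deriv K z)\<^sup>2"
    using schwarzian_wedge[OF K(1)] a by simp
  moreover have "1 - a\<^sup>2 > 0"
    using a by (simp add: power_less_one_iff)
  ultimately have "cmod (schwarzian (wedge_disk a) z) * (1 - (cmod z)\<^sup>2)\<^sup>2
      = (1 - a\<^sup>2) / (2 * (cmod (K z))\<^sup>2) * (cmod (deriv K z) * (1 - (cmod z)\<^sup>2))\<^sup>2"
    by (simp only: norm_mult norm_divide norm_power norm_of_real abs_of_pos power_mult_distrib) simp
  also have "\<dots> = 2 * (1 - a\<^sup>2) * (Re (K z) / cmod (K z))\<^sup>2"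
    unfolding K(2) by (simp add: power_mult_distrib power_divide)
  also have "\<dots> \<le> 2 * (1 - a\<^sup>2) * 1"
  proof (intro mult_left_mono)
    have "Re (K z) / cmod (K z) \<le> 1" "0 \<le> Re (K z) / cmod (K z)"
      using K(1) complex_Re_le_cmod[of "K z"] half_plane_Ln[OF K(1)] by (auto simp: half_plane_def)
    then show "(Re (K z) / cmod (K z))\<^sup>2 \<le> 1"
      by (simp add: power_le_one)
  qed (use \<open>1 - a\<^sup>2 > 0\<close> in simp)
  finally show ?thesis
    by simp
qed

lemma wedge_disk_covers_quadrant:
  assumes "1 / 2 \<le> a" "a < 1" "0 < Re w" "0 < Im w"
  shows "\<exists>z\<in>unit_disk. wedge_disk a z = w"
proof -
  obtain u where u: "u \<in> half_plane" "wedge a u = w"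
    using wedge_covers_quadrant[OF assms] by blast
  define z where "z = (u - 1) / (u + 1)"
  have n: "u + 1 \<noteq> 0"
    using u by (auto simp: half_plane_def complex_eq_iff)
  have "(cmod (u - 1))\<^sup>2 < (cmod (u + 1))\<^sup>2"
    using u(1) unfolding cmod_power2 by (simp add: half_plane_def power2_eq_square algebra_simps)
  then have "cmod (u - 1) < cmod (u + 1)"
    by (rule power2_less_imp_less) simp
  then have "z \<in> unit_disk"
    using n by (simp add: z_def norm_divide)
  moreover have "linear_fractional 1 1 (-1) 1 z = u"
    using n by (simp add: linear_fractional_def z_def divide_simps)
  ultimately show ?thesis
    using u by (auto simp: wedge_disk_def)
qed

text \<open>The map \<open>s (w - \<i>) / (1 - \<i> w)\<close> is an automorphism of the right half-plane sending \<open>\<i>\<close> to \<open>0\<close> and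
\<open>-\<i>\<close> to \<open>\<infinity>\<close>; a small \<open>s\<close> pulls every set that avoids a neighbourhood of \<open>-\<i>\<close> close to \<open>0\<close>.\<close>
lemma half_plane_shrink:
  assumes s: "0 < s" and w: "w \<in> half_plane"
  shows "- \<i> * w + 1 \<noteq> 0"
    and "linear_fractional (of_real s) (- \<i> * of_real s) (- \<i>) 1 w \<in> half_plane"
proof -
  define m where "m = linear_fractional (of_real s) (- \<i> * of_real s) (- \<i>) 1 w"
  show nz: "- \<i> * w + 1 \<noteq> 0"
    using w by (auto simp: half_plane_def complex_eq_iff)
  then have n: "(cmod (- \<i> * w + 1))\<^sup>2 > 0"
    by auto
  have "Re m = 2 * s * Re w / (cmod (- \<i> * w + 1))\<^sup>2"
    by (simp add: m_def linear_fractional_def Re_divide cmod_power2) (simp add: power2_eq_square algebra_simps)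
  then show "m \<in> half_plane"
    using n s w by (simp add: half_plane_def)
qed

text \<open>The hypothesis on \<open>w\<close> gives \<open>|1 - \<i> w|\<^sup>2 = |w|\<^sup>2 + 1 + 2 Im w \<ge> (1 - k) (|w|\<^sup>2 + 1)\<close>, while
\<open>|w - \<i>|\<^sup>2 \<le> 2 (|w|\<^sup>2 + 1)\<close>; so \<open>w\<close> stays away from the pole uniformly, even for large \<open>w\<close>.\<close>
lemma half_plane_shrink_bound:
  assumes s: "0 < s" and k: "0 \<le> k" "k < 1" and w: "w \<in> half_plane" "- Im w \<le> k * cmod w"
  shows "cmod (linear_fractional (of_real s) (- \<i> * of_real s) (- \<i>) 1 w) \<le> s * sqrt (2 / (1 - k))"
proof -
  have nz: "cmod (- \<i> * w + 1) > 0"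
    using half_plane_shrink(1)[OF s w(1)] by simp
  have n1: "(cmod (- \<i> * w + 1))\<^sup>2 = (cmod w)\<^sup>2 + 1 + 2 * Im w"
    unfolding cmod_power2 by (simp add: power2_eq_square algebra_simps)
  have n2: "(cmod (w - \<i>))\<^sup>2 = (cmod w)\<^sup>2 + 1 - 2 * Im w"
    unfolding cmod_power2 by (simp add: power2_eq_square algebra_simps)
  have "2 * cmod w \<le> (cmod w)\<^sup>2 + 1"
    using sum_squares_bound[of "cmod w" 1] by simp
  moreover have "- Im w \<le> cmod w"
    using abs_Im_le_cmod[of w] by (simp add: abs_le_iff)
  ultimately have u: "(cmod (w - \<i>))\<^sup>2 \<le> 2 * ((cmod w)\<^sup>2 + 1)"
    unfolding n2 by (simp add: field_simps)
  have l: "(1 - k) * ((cmod w)\<^sup>2 + 1) \<le> (cmod (- \<i> * w + 1))\<^sup>2"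
  proof -
    have "k * (2 * cmod w) \<le> k * ((cmod w)\<^sup>2 + 1)"
      using \<open>2 * cmod w \<le> (cmod w)\<^sup>2 + 1\<close> k(1) by (rule mult_left_mono)
    then show ?thesis
      unfolding n1 using w(2) by (simp add: algebra_simps)
  qed
  have "(cmod (w - \<i>) / cmod (- \<i> * w + 1))\<^sup>2 \<le> 2 / (1 - k)"
  proof -
    have "(cmod (w - \<i>))\<^sup>2 * (1 - k) \<le> 2 * ((cmod w)\<^sup>2 + 1) * (1 - k)"
      using u k by (intro mult_right_mono) auto
    also have "\<dots> \<le> 2 * (cmod (- \<i> * w + 1))\<^sup>2"
      using mult_left_mono[OF l, of 2] by (simp only: mult_ac)
    finally show ?thesis
      using k nz by (simp add: power_divide divide_simps mult.commute)
  qed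
  then have "cmod (w - \<i>) / cmod (- \<i> * w + 1) \<le> sqrt (2 / (1 - k))"
    by (rule real_le_rsqrt)
  then have "s * (cmod (w - \<i>) / cmod (- \<i> * w + 1)) \<le> s * sqrt (2 / (1 - k))"
    using s by (intro mult_left_mono) auto
  moreover have "linear_fractional (of_real s) (- \<i> * of_real s) (- \<i>) 1 w = of_real s * ((w - \<i>) / (- \<i> * w + 1))"
    by (simp add: linear_fractional_def algebra_simps)
  ultimately show ?thesis
    using s by (simp only: norm_mult norm_divide norm_of_real abs_of_pos)
qed

text \<open>The map \<open>\<zeta> (1 - v) / (1 + v)\<close> takes the half-plane to the disk and \<open>0\<close> to \<open>\<zeta>\<close>; the last inequality
says that points near \<open>0\<close> end up near the unit circle.\<close>
lemma half_plane_to_disk: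
  assumes "cmod \<zeta> = 1" "v \<in> half_plane"
  shows "1 * v + 1 \<noteq> 0" "linear_fractional (- \<zeta>) \<zeta> 1 1 v \<in> unit_disk" "1 - 2 * cmod v \<le> cmod (linear_fractional (- \<zeta>) \<zeta> 1 1 v)"
proof -
  show "1 * v + 1 \<noteq> 0"
    using assms by (auto simp: half_plane_def complex_eq_iff)
  then have pos: "cmod (1 + v) > 0"
    by (simp add: add.commute)
  have "(cmod (1 - v))\<^sup>2 < (cmod (1 + v))\<^sup>2"
    using assms(2) unfolding cmod_power2 by (simp add: half_plane_def power2_eq_square algebra_simps)
  then have less: "cmod (1 - v) < cmod (1 + v)"
    by (rule power2_less_imp_less) simp
  have "linear_fractional (- \<zeta>) \<zeta> 1 1 v = \<zeta> * ((1 - v) / (1 + v))"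
    by (simp add: linear_fractional_def algebra_simps)
  then have eq: "cmod (linear_fractional (- \<zeta>) \<zeta> 1 1 v) = cmod (1 - v) / cmod (1 + v)"
    using assms by (simp add: norm_mult norm_divide)
  with less pos show "linear_fractional (- \<zeta>) \<zeta> 1 1 v \<in> unit_disk"
    by simp
  have "1 \<le> cmod (1 + v)"
    using assms complex_Re_le_cmod[of "1 + v"] by (simp add: half_plane_def)
  then have "2 * cmod v * 1 \<le> 2 * cmod v * cmod (1 + v)"
    by (intro mult_left_mono) auto
  moreover have "cmod (1 + v) - 2 * cmod v \<le> cmod (1 - v)"
    using norm_triangle_ineq2[of "1 + v" "2 * v"] by (simp add: norm_mult)
  ultimately have "(1 - 2 * cmod v) * cmod (1 + v) \<le> cmod (1 - v)"
    by (simp add: algebra_simps)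
  then show "1 - 2 * cmod v \<le> cmod (linear_fractional (- \<zeta>) \<zeta> 1 1 v)"
    using pos by (simp add: eq pos_le_divide_eq)
qed

text \<open>The preimage is computed explicitly: with \<open>u = z / \<zeta>\<close> and \<open>x = (1 - u) / ((1 + u) s)\<close> it is
\<open>(x + \<i>) / (1 + \<i> x)\<close>, whose imaginary part is positive exactly when \<open>|x| < 1\<close>.\<close>
lemma quadrant_covers_near_boundary:
  assumes \<zeta>: "cmod \<zeta> = 1" and s: "0 < s"
    and z: "z \<in> unit_disk" "cmod (z - \<zeta>) < 1" "cmod (z - \<zeta>) < s"
  shows "\<exists>w. 0 < Re w \<and> 0 < Im w \<and>
    linear_fractional (- \<zeta>) \<zeta> 1 1 (linear_fractional (of_real s) (- \<i> * of_real s) (- \<i>) 1 w) = z"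
proof -
  define u where "u = z / \<zeta>"
  define x where "x = (1 - u) / (1 + u) / of_real s"
  define w where "w = (x + \<i>) / (1 + \<i> * x)"
  have \<zeta>0: "\<zeta> \<noteq> 0"
    using \<zeta> by auto
  have u: "cmod u < 1" "cmod (1 - u) < 1" "cmod (1 - u) < s"
  proof -
    have "1 - u = (\<zeta> - z) / \<zeta>"
      using \<zeta>0 by (simp add: u_def field_simps)
    then have "cmod (1 - u) = cmod (z - \<zeta>)"
      using \<zeta> by (simp add: norm_divide norm_minus_commute)
    then show "cmod (1 - u) < 1" "cmod (1 - u) < s"
      using z by simp_all
    show "cmod u < 1"
      using \<zeta> z by (simp add: u_def norm_divide)
  qed
  have "1 - cmod (1 - u) \<le> Re u"
    using complex_Re_le_cmod[of "1 - u"] by simp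
  then have u1: "1 \<le> cmod (1 + u)"
    using u complex_Re_le_cmod[of "1 + u"] by simp
  then have u1': "1 + u \<noteq> 0"
    by auto
  have "cmod (1 - u) / cmod (1 + u) \<le> cmod (1 - u)"
    using u1 by (simp add: divide_le_eq mult_left_le_one_le mult_le_cancel_left1)
  moreover have "cmod x = cmod (1 - u) / cmod (1 + u) / s"
    using s by (simp only: x_def norm_divide norm_of_real abs_of_pos)
  ultimately have x1: "cmod x < 1"
    using u(3) s by (simp only: divide_less_eq_1_pos)
  have x0: "0 < Re x"
  proof -
    have "Re ((1 - u) / (1 + u)) = (1 - (cmod u)\<^sup>2) / (cmod (1 + u))\<^sup>2"
      by (simp add: Re_divide cmod_power2) (simp add: power2_eq_square algebra_simps)
    moreover have "1 - (cmod u)\<^sup>2 > 0"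
      using u(1) by (simp add: power_less_one_iff)
    moreover have "Re x = Re ((1 - u) / (1 + u)) / s"
      by (simp only: x_def Re_divide_of_real)
    ultimately show ?thesis
      using u1' s by simp
  qed
  have ix: "1 + \<i> * x \<noteq> 0"
    using x0 by (auto simp: complex_eq_iff)
  then have n: "(cmod (1 + \<i> * x))\<^sup>2 > 0"
    by auto
  have "Re w = 2 * Re x / (cmod (1 + \<i> * x))\<^sup>2"
    by (simp add: w_def Re_divide cmod_power2) (simp add: power2_eq_square algebra_simps)
  then have "0 < Re w"
    using n x0 by simp
  moreover have "Im w = (1 - (cmod x)\<^sup>2) / (cmod (1 + \<i> * x))\<^sup>2"
    by (simp add: w_def Im_divide cmod_power2) (simp add: power2_eq_square algebra_simps)
  then have "0 < Im w"
    using n x1 by (simp add: power_less_one_iff)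
  moreover have "linear_fractional (of_real s) (- \<i> * of_real s) (- \<i>) 1 w = of_real s * x"
  proof -
    have "w - \<i> = 2 * x / (1 + \<i> * x)" "- \<i> * w + 1 = 2 / (1 + \<i> * x)"
      using ix by (simp_all add: w_def field_simps)
    moreover have "linear_fractional (of_real s) (- \<i> * of_real s) (- \<i>) 1 w
        = of_real s * ((w - \<i>) / (- \<i> * w + 1))"
      by (simp add: linear_fractional_def algebra_simps)
    ultimately show ?thesis
      using ix by simp
  qed
  moreover have "linear_fractional (- \<zeta>) \<zeta> 1 1 (of_real s * x) = z"
  proof -
    have "of_real s * x = (1 - u) / (1 + u)"
      using s by (simp add: x_def)
    moreover have "1 - (1 - u) / (1 + u) = 2 * u / (1 + u)" "1 + (1 - u) / (1 + u) = 2 / (1 + u)"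
      using u1' by (simp_all add: field_simps)
    moreover have "linear_fractional (- \<zeta>) \<zeta> 1 1 v = \<zeta> * ((1 - v) / (1 + v))" for v
      by (simp add: linear_fractional_def algebra_simps)
    ultimately show ?thesis
      using u1' \<zeta>0 by (simp add: u_def)
  qed
  ultimately show ?thesis
    by auto
qed

text \<open>The image of \<open>\<phi>\<close> is a lune inside the unit disk: it is bounded by an arc of the unit circle
around \<open>\<zeta>\<close> and by a circular arc meeting it at an angle \<open>a \<pi>\<close>. The angle, and with it the
Schwarzian norm of \<open>\<phi>\<close>, depends only on \<open>\<epsilon>\<close>; a disk automorphism then pushes the lune into the
annulus \<open>r < |z| < 1\<close> without changing the Schwarzian. A disk internally tangent to the unit circle
would have Schwarzian norm zero, but contains no relative neighbourhood of \<open>\<zeta>\<close>.\<close>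
lemma boundary_chart:
  assumes \<epsilon>: "0 < \<epsilon>" and r: "r < 1" and \<zeta>: "cmod \<zeta> = 1"
  obtains \<phi> \<rho> where "\<phi> holomorphic_on unit_disk" "inj_on \<phi> unit_disk" "\<phi> ` unit_disk \<subseteq> unit_disk"
    "\<And>z. z \<in> unit_disk \<Longrightarrow> r < cmod (\<phi> z)"
    "\<And>z. z \<in> unit_disk \<Longrightarrow> cmod (schwarzian \<phi> z) * (1 - (cmod z)\<^sup>2)\<^sup>2 \<le> \<epsilon>"
    "0 < \<rho>" "ball \<zeta> \<rho> \<inter> unit_disk \<subseteq> \<phi> ` unit_disk"
proof -
  (* This choice gives 2 * (1 - a^2) \<le> 4 * (1 - a) \<le> \<epsilon>. *)
  define a where "a = 1 - min \<epsilon> 2 / 4"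
  have a: "1 / 2 \<le> a" "0 < a" "a < 1"
    using \<epsilon> by (auto simp: a_def)
  define k where "k = \<bar>cos (a * pi)\<bar>"
  have "a * pi < 1 * pi"
    using a by (intro mult_strict_right_mono) auto
  then have "cos pi < cos (a * pi)" "cos (a * pi) < cos 0"
    using a by (intro cos_monotone_0_pi; simp)+
  then have k: "0 \<le> k" "k < 1"
    by (auto simp: k_def abs_if)
  define R where "R = sqrt (2 / (1 - k))"
  have R: "0 < R"
    using k by (simp add: R_def)
  (* The shrunken lune lies within s * R of 0, which must be less than (1 - r) / 2. *)
  define s where "s = (1 - r) / (4 * R)"
  have s: "0 < s"
    using r R by (simp add: s_def)
  have sR: "2 * (s * R) < 1 - r"
    using r R by (simp add: s_def)
  define T where "T = linear_fractional (of_real s) (- \<i> * of_real s) (- \<i>) 1"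
  define C where "C = linear_fractional (- \<zeta>) \<zeta> 1 1"
  define v where "v z = T (wedge_disk a z)" for z
  define \<phi> where "\<phi> z = C (v z)" for z
  have \<zeta>0: "\<zeta> \<noteq> 0"
    using \<zeta> by auto
  have wd: "wedge_disk a z \<in> half_plane" "- Im (wedge_disk a z) \<le> k * cmod (wedge_disk a z)"
    if "z \<in> unit_disk" for z
    using wedge_argument[OF a(1,3) cayley_properties(2)[OF that]]
    by (simp_all add: wedge_disk_def half_plane_def k_def)
  have v: "v z \<in> half_plane" "cmod (v z) \<le> s * R" if "z \<in> unit_disk" for z
    using half_plane_shrink(2)[OF s wd(1)[OF that]] half_plane_shrink_bound[OF s k wd[OF that]]
    by (simp_all add: v_def T_def R_def)
  have dets: "of_real s * 1 - - \<i> * of_real s * - \<i> \<noteq> (0::complex)" "- \<zeta> * 1 - \<zeta> * 1 \<noteq> 0"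
    using s \<zeta>0 by auto
  have v_inj: "inj_on v unit_disk"
    unfolding v_def[abs_def] T_def
    by (intro linear_fractional_compose_inj dets(1) wedge_disk_inj a half_plane_shrink(1)[OF s wd(1)])
  have v_hol: "v holomorphic_on unit_disk"
    unfolding v_def[abs_def] T_def
    by (intro linear_fractional_compose_holomorphic wedge_disk_holomorphic half_plane_shrink(1)[OF s wd(1)])
  have \<phi>_hol: "\<phi> holomorphic_on unit_disk"
    unfolding \<phi>_def[abs_def] C_def
    by (intro linear_fractional_compose_holomorphic v_hol half_plane_to_disk(1)[OF \<zeta> v(1)])
  have \<phi>_inj: "inj_on \<phi> unit_disk"
    unfolding \<phi>_def[abs_def] C_def
    by (intro linear_fractional_compose_inj v_inj dets(2) half_plane_to_disk(1)[OF \<zeta> v(1)])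
  have \<phi>_disk: "\<phi> ` unit_disk \<subseteq> unit_disk"
    using half_plane_to_disk(2)[OF \<zeta> v(1)] by (auto simp: \<phi>_def C_def)
  have \<phi>_r: "r < cmod (\<phi> z)" if "z \<in> unit_disk" for z
    using half_plane_to_disk(3)[OF \<zeta> v(1)[OF that]] v(2)[OF that] sR by (simp add: \<phi>_def C_def)
  have \<phi>_S: "cmod (schwarzian \<phi> z) * (1 - (cmod z)\<^sup>2)\<^sup>2 \<le> \<epsilon>" if "z \<in> unit_disk" for z
  proof -
    have "schwarzian \<phi> z = schwarzian v z"
      unfolding \<phi>_def[abs_def] C_def
      using holomorphic_injective_imp_regular[OF v_hol open_ball v_inj]
      by (intro schwarzian_linear_fractional_compose[OF open_ball v_hol _ that dets(2)] half_plane_to_disk(1)[OF \<zeta> v(1)])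
    also have "\<dots> = schwarzian (wedge_disk a) z"
      unfolding v_def[abs_def] T_def
      by (intro schwarzian_linear_fractional_compose[OF open_ball wedge_disk_holomorphic _ that dets(1)]
          half_plane_shrink(1)[OF s wd(1)] wedge_disk_deriv_nonzero[OF a(2,3)])
    finally have "cmod (schwarzian \<phi> z) * (1 - (cmod z)\<^sup>2)\<^sup>2 \<le> 2 * (1 - a\<^sup>2)"
      using schwarzian_wedge_disk[OF a(2,3) that] by simp
    also have "\<dots> = 2 * (1 + a) * (1 - a)"
      by (simp add: power2_eq_square algebra_simps)
    also have "\<dots> \<le> 4 * (1 - a)"
      using a by (intro mult_right_mono) auto
    also have "\<dots> \<le> \<epsilon>"
      by (simp add: a_def)
    finally show ?thesis .
  qed
  have cover: "ball \<zeta> (min 1 s) \<inter> unit_disk \<subseteq> \<phi> ` unit_disk"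
  proof
    fix z assume "z \<in> ball \<zeta> (min 1 s) \<inter> unit_disk"
    then have z: "z \<in> unit_disk" "cmod (z - \<zeta>) < 1" "cmod (z - \<zeta>) < s"
      by (auto simp: dist_norm norm_minus_commute)
    obtain w where w: "0 < Re w" "0 < Im w" "C (T w) = z"
      using quadrant_covers_near_boundary[OF \<zeta> s z] by (auto simp: C_def T_def)
    obtain y where "y \<in> unit_disk" "wedge_disk a y = w"
      using wedge_disk_covers_quadrant[OF a(1,3) w(1,2)] by blast
    with w(3) show "z \<in> \<phi> ` unit_disk"
      by (auto simp: \<phi>_def v_def)
  qed
  show ?thesis
    using that[OF \<phi>_hol \<phi>_inj \<phi>_disk \<phi>_r \<phi>_S _ cover] s by simp
qed

section \<open>Harmonic mappings composed with conformal self-maps of the disk\<close>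

lemma harmonic_deriv_nonzero:
  assumes "orientation_preserving_harmonic f h g" "z \<in> unit_disk"
  shows "deriv h z \<noteq> 0"
proof
  assume "deriv h z = 0"
  moreover have "jacobian_H h g z > 0"
    using assms unfolding orientation_preserving_harmonic_def by blast
  moreover have "0 \<le> (cmod (deriv g z))\<^sup>2"
    by simp
  ultimately show False
    unfolding jacobian_H_def by simp
qed

text \<open>Subtracting the constant restores the normalisation \<open>g 0 = 0\<close> and does not affect injectivity.\<close>
lemma orientation_preserving_harmonic_compose:
  assumes f: "orientation_preserving_harmonic f h g"
    and \<phi>: "\<phi> holomorphic_on unit_disk" "inj_on \<phi> unit_disk" "\<phi> ` unit_disk \<subseteq> unit_disk"
  shows "orientation_preserving_harmonic (\<lambda>z. f (\<phi> z) - cnj (g (\<phi> 0)))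
    (\<lambda>z. h (\<phi> z)) (\<lambda>z. g (\<phi> z) - g (\<phi> 0))"
proof -
  have h: "h holomorphic_on unit_disk" and g: "g holomorphic_on unit_disk"
    and eq: "\<And>z. z \<in> unit_disk \<Longrightarrow> f z = h z + cnj (g z)"
    and loc: "locally_univalent_on f unit_disk"
    and jac: "\<And>z. z \<in> unit_disk \<Longrightarrow> jacobian_H h g z > 0"
    using f by (auto simp: orientation_preserving_harmonic_def canonical_rep_def)
  note comp = deriv_compose_on[OF open_ball open_ball \<phi>(1,3)]
  have "(\<lambda>z. h (\<phi> z)) holomorphic_on unit_disk" "(\<lambda>z. g (\<phi> z)) holomorphic_on unit_disk"
    using holomorphic_on_compose_gen[OF \<phi>(1) h \<phi>(3)] holomorphic_on_compose_gen[OF \<phi>(1) g \<phi>(3)]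
    by (simp_all add: o_def)
  then have "canonical_rep (\<lambda>z. f (\<phi> z) - cnj (g (\<phi> 0))) (\<lambda>z. h (\<phi> z)) (\<lambda>z. g (\<phi> z) - g (\<phi> 0))"
    using eq \<phi>(3) by (auto simp: canonical_rep_def image_subset_iff intro!: holomorphic_intros)
  moreover have "locally_univalent_on (\<lambda>z. f (\<phi> z) - cnj (g (\<phi> 0))) unit_disk"
    unfolding locally_univalent_on_def
  proof
    fix z assume z: "z \<in> unit_disk"
    with loc \<phi>(3) obtain r where r: "r > 0" "ball (\<phi> z) r \<subseteq> unit_disk" "inj_on f (ball (\<phi> z) r)"
      unfolding locally_univalent_on_def by blast
    have "open (unit_disk \<inter> \<phi> -` ball (\<phi> z) r)"
      using holomorphic_on_imp_continuous_on[OF \<phi>(1)] by (intro continuous_open_preimage) auto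
    then obtain \<rho> where \<rho>: "\<rho> > 0" "ball z \<rho> \<subseteq> unit_disk \<inter> \<phi> -` ball (\<phi> z) r"
      using z r(1) openE[of "unit_disk \<inter> \<phi> -` ball (\<phi> z) r" z] by (metis IntI vimageI2 centre_in_ball)
    have "inj_on (\<lambda>z. f (\<phi> z) - cnj (g (\<phi> 0))) (ball z \<rho>)"
    proof (rule inj_onI)
      fix x y assume xy: "x \<in> ball z \<rho>" "y \<in> ball z \<rho>"
        "f (\<phi> x) - cnj (g (\<phi> 0)) = f (\<phi> y) - cnj (g (\<phi> 0))"
      then have "x \<in> unit_disk" "y \<in> unit_disk" "\<phi> x \<in> ball (\<phi> z) r" "\<phi> y \<in> ball (\<phi> z) r"
        using \<rho>(2) by blast+
      moreover from xy(3) have "f (\<phi> x) = f (\<phi> y)"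
        by simp
      ultimately show "x = y"
        using inj_onD[OF r(3)] inj_onD[OF \<phi>(2)] by blast
    qed
    with \<rho> show "\<exists>r>0. ball z r \<subseteq> unit_disk \<and> inj_on (\<lambda>z. f (\<phi> z) - cnj (g (\<phi> 0))) (ball z r)"
      by blast
  qed
  moreover have "jacobian_H (\<lambda>z. h (\<phi> z)) (\<lambda>z. g (\<phi> z) - g (\<phi> 0)) z > 0" if z: "z \<in> unit_disk" for z
  proof -
    have "deriv (\<lambda>z. g (\<phi> z) - g (\<phi> 0)) z = deriv g (\<phi> z) * deriv \<phi> z"
      using DERIV_diff[OF comp(2)[OF g z] DERIV_const[of "g (\<phi> 0)"]] by (simp add: DERIV_imp_deriv)
    then have "jacobian_H (\<lambda>z. h (\<phi> z)) (\<lambda>z. g (\<phi> z) - g (\<phi> 0)) z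
        = jacobian_H h g (\<phi> z) * (cmod (deriv \<phi> z))\<^sup>2"
      using comp(1)[OF h z]
      by (simp add: jacobian_H_def norm_mult power_mult_distrib algebra_simps)
    moreover have "deriv \<phi> z \<noteq> 0"
      using holomorphic_injective_imp_regular[OF \<phi>(1) open_ball \<phi>(2) z] .
    ultimately show ?thesis
      using jac[of "\<phi> z"] \<phi>(3) z by (simp add: image_subset_iff)
  qed
  ultimately show ?thesis
    by (simp add: orientation_preserving_harmonic_def)
qed

text \<open>By the composition rule the Schwarzian of \<open>f \<circ> \<phi>\<close> has two parts; the Schwarz-Pick inequality bounds
the weighted part coming from \<open>f\<close> by the weighted Schwarzian of \<open>f\<close> at \<open>\<phi> z\<close>.\<close>
lemma schwarzian_norm_H_compose_le:
  assumes f: "orientation_preserving_harmonic f h g"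
    and \<phi>: "\<phi> holomorphic_on unit_disk" "inj_on \<phi> unit_disk" "\<phi> ` unit_disk \<subseteq> unit_disk"
    and bound: "\<And>z. z \<in> unit_disk \<Longrightarrow> weighted_schwarzian_H h g (\<phi> z) \<le> \<beta>"
    and small: "\<And>z. z \<in> unit_disk \<Longrightarrow> cmod (schwarzian \<phi> z) * (1 - (cmod z)\<^sup>2)\<^sup>2 \<le> \<epsilon>"
  shows "schwarzian_norm_H (\<lambda>z. h (\<phi> z)) (\<lambda>z. g (\<phi> z) - g (\<phi> 0)) \<le> ereal (\<beta> + \<epsilon>)"
  unfolding schwarzian_norm_H_def
proof (rule SUP_least)
  fix z :: complex assume z: "z \<in> unit_disk"
  have hg: "h holomorphic_on unit_disk" "g holomorphic_on unit_disk"
    using f by (auto simp: orientation_preserving_harmonic_def canonical_rep_def)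
  have regular: "deriv \<phi> w \<noteq> 0" if "w \<in> unit_disk" for w
    using holomorphic_injective_imp_regular[OF \<phi>(1) open_ball \<phi>(2) that] .
  let ?S = "schwarzian_H h g (\<phi> z)"
  have "(cmod (deriv \<phi> z) * (1 - (cmod z)\<^sup>2))\<^sup>2 \<le> (1 - (cmod (\<phi> z))\<^sup>2)\<^sup>2"
    using schwarz_pick[OF \<phi>(1,3) z] z by (intro power_mono) (auto simp: power_le_one)
  then have "cmod ?S * (cmod (deriv \<phi> z) * (1 - (cmod z)\<^sup>2))\<^sup>2 \<le> cmod ?S * (1 - (cmod (\<phi> z))\<^sup>2)\<^sup>2"
    by (rule mult_left_mono) simp
  also have "\<dots> \<le> \<beta>"
    using bound[OF z] by (simp add: weighted_schwarzian_H_def)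
  finally have outer: "cmod (?S * (deriv \<phi> z)\<^sup>2) * (1 - (cmod z)\<^sup>2)\<^sup>2 \<le> \<beta>"
    by (simp add: norm_mult norm_power power_mult_distrib mult.assoc)
  have "weighted_schwarzian_H (\<lambda>z. h (\<phi> z)) (\<lambda>z. g (\<phi> z) - g (\<phi> 0)) z
      = cmod (?S * (deriv \<phi> z)\<^sup>2 + schwarzian \<phi> z) * (1 - (cmod z)\<^sup>2)\<^sup>2"
    unfolding weighted_schwarzian_H_def
    using schwarzian_H_compose[OF open_ball open_ball \<phi>(1,3) hg harmonic_deriv_nonzero[OF f] regular z]
    by simp
  also have "\<dots> \<le> (cmod (?S * (deriv \<phi> z)\<^sup>2) + cmod (schwarzian \<phi> z)) * (1 - (cmod z)\<^sup>2)\<^sup>2"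
    by (intro mult_right_mono norm_triangle_ineq) simp
  also have "\<dots> \<le> \<beta> + \<epsilon>"
    using outer small[OF z] by (simp add: distrib_right)
  finally show "ereal (weighted_schwarzian_H (\<lambda>z. h (\<phi> z)) (\<lambda>z. g (\<phi> z) - g (\<phi> 0)) z) \<le> ereal (\<beta> + \<epsilon>)"
    by simp
qed

section \<open>From local injectivity to bounded valence\<close>

lemma multiplicity_H_eq_1:
  assumes "deriv h z \<noteq> 0"
  shows "multiplicity_H h z = 1"
  unfolding multiplicity_H_def
proof (rule Least_equality)
  show "0 < (1::nat) \<and> (deriv ^^ 1) h z \<noteq> 0"
    using assms by simp
qed simp

text \<open>Each member of the cover contains at most one point of a fibre.\<close>
lemma finite_fibre_of_injective_cover:
  assumes fin: "finite \<U>" and cov: "S \<subseteq> \<Union>\<U>"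
    and inj: "\<And>U. U \<in> \<U> \<Longrightarrow> inj_on f (U \<inter> S)"
  shows "finite {z \<in> S. f z = w} \<and> card {z \<in> S. f z = w} \<le> card \<U>"
proof -
  have "\<forall>z\<in>S. \<exists>U. U \<in> \<U> \<and> z \<in> U"
    using cov by blast
  then obtain c where c: "\<And>z. z \<in> S \<Longrightarrow> c z \<in> \<U> \<and> z \<in> c z"
    using bchoice by metis
  have "inj_on c {z \<in> S. f z = w}"
  proof (rule inj_onI)
    fix x y assume xy: "x \<in> {z \<in> S. f z = w}" "y \<in> {z \<in> S. f z = w}" "c x = c y"
    then have "x \<in> c x \<inter> S" "y \<in> c x \<inter> S" "c x \<in> \<U>" "f x = f y"
      using c by auto
    then show "x = y"
      using inj_onD[OF inj] by blast
  qed
  moreover have "c ` {z \<in> S. f z = w} \<subseteq> \<U>"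
    using c by auto
  ultimately show ?thesis
    using fin by (meson card_inj_on_le inj_on_finite)
qed

text \<open>Local injectivity, which holds inside the disk, together with injectivity on one-sided neighbourhoods
of the boundary points gives an open cover of the compact closed disk; a finite subcover bounds all
fibres at once. Multiplicities do not increase the count, because \<open>h'\<close> has no zeros.\<close>
lemma bounded_valence_of_local_injectivity:
  assumes f: "orientation_preserving_harmonic f h g"
    and loc: "\<And>\<zeta>. cmod \<zeta> = 1 \<Longrightarrow> \<exists>\<rho>>0. inj_on f (ball \<zeta> \<rho> \<inter> unit_disk)"
  shows "\<exists>N::nat. N > 0 \<and> (\<forall>w. valence_H f h w \<le> enat N)"
proof -
  have "\<exists>\<rho>>0. inj_on f (ball x \<rho> \<inter> unit_disk)" if x: "x \<in> cball 0 1" for x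
  proof (cases "cmod x = 1")
    case False
    with x have "x \<in> unit_disk"
      by auto
    with f obtain \<rho> where "\<rho> > 0" "inj_on f (ball x \<rho>)"
      unfolding orientation_preserving_harmonic_def locally_univalent_on_def by blast
    then show ?thesis
      by (meson inf_le1 inj_on_subset)
  qed (rule loc)
  then obtain \<rho> where \<rho>: "\<And>x. x \<in> cball 0 1 \<Longrightarrow> \<rho> x > 0 \<and> inj_on f (ball x (\<rho> x) \<inter> unit_disk)"
    by metis
  have "cball 0 1 \<subseteq> (\<Union>x\<in>cball 0 1. ball x (\<rho> x))"
    using \<rho> by force
  then obtain X where X: "X \<subseteq> cball 0 1" "finite X" "cball 0 1 \<subseteq> (\<Union>x\<in>X. ball x (\<rho> x))"
    using compactE_image[OF compact_cball, of "cball 0 1" "\<lambda>x. ball x (\<rho> x)" 0 1] by auto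
  define \<U> where "\<U> = (\<lambda>x. ball x (\<rho> x)) ` X"
  have fibre: "finite {z \<in> unit_disk. f z = w} \<and> card {z \<in> unit_disk. f z = w} \<le> card \<U>" for w
  proof (rule finite_fibre_of_injective_cover)
    show "finite \<U>"
      using X by (simp add: \<U>_def)
    show "unit_disk \<subseteq> \<Union>\<U>"
      using X(3) ball_subset_cball unfolding \<U>_def by blast
    show "inj_on f (U \<inter> unit_disk)" if "U \<in> \<U>" for U
      using that X(1) \<rho> by (auto simp: \<U>_def)
  qed
  have "valence_H f h w \<le> enat (Suc (card \<U>))" for w
  proof -
    have "(\<Sum>z\<in>{z \<in> unit_disk. f z = w}. multiplicity_H h z) = card {z \<in> unit_disk. f z = w}"
      using multiplicity_H_eq_1[OF harmonic_deriv_nonzero[OF f]] by simp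
    then show ?thesis
      using fibre[of w] by (simp add: valence_H_def)
  qed
  then show ?thesis
    by blast
qed

theorem theorem2:
  fixes \<delta>\<^sub>0 :: real and f h g :: "complex \<Rightarrow> complex"
  assumes "\<delta>\<^sub>0 > 0"
    and "\<And>F H G. orientation_preserving_harmonic F H G \<Longrightarrow>
           schwarzian_norm_H H G \<le> ereal \<delta>\<^sub>0 \<Longrightarrow> inj_on F unit_disk"
    and "\<And>F H G t. orientation_preserving_harmonic F H G \<Longrightarrow> t < 1 \<Longrightarrow>
           schwarzian_norm_H H G \<le> ereal (\<delta>\<^sub>0 * t) \<Longrightarrow> has_quasiconformal_extension F"
    and "orientation_preserving_harmonic f h g"
    and "Limsup at_unit_circle (\<lambda>z. ereal (weighted_schwarzian_H h g z)) < ereal \<delta>\<^sub>0"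
  shows "\<exists>N::nat. N > 0 \<and> (\<forall>w. valence_H f h w \<le> enat N)"
proof (rule bounded_valence_of_local_injectivity[OF assms(4)])
  fix \<zeta> :: complex assume \<zeta>: "cmod \<zeta> = 1"
  (* The room between \<beta> and \<delta>\<^sub>0 is spent on the Schwarzian of the lune map. *)
  obtain \<beta> where \<beta>: "Limsup at_unit_circle (\<lambda>z. ereal (weighted_schwarzian_H h g z)) < ereal \<beta>" "\<beta> < \<delta>\<^sub>0"
    using ereal_dense2[OF assms(5)] by auto
  from Limsup_lessD[OF \<beta>(1)] obtain P where P: "eventually P (at_left (1::real))"
    and P_small: "\<And>z. P (cmod z) \<Longrightarrow> weighted_schwarzian_H h g z < \<beta>"
    unfolding at_unit_circle_def eventually_filtercomap less_ereal.simps(1) by blast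
  from P obtain r where r: "r < 1" and "\<And>x. r < x \<Longrightarrow> x < 1 \<Longrightarrow> P x"
    unfolding eventually_at_left[OF zero_less_one] by blast
  with P_small have small: "\<And>z. r < cmod z \<Longrightarrow> cmod z < 1 \<Longrightarrow> weighted_schwarzian_H h g z < \<beta>"
    by blast
  obtain \<phi> \<rho> where \<phi>: "\<phi> holomorphic_on unit_disk" "inj_on \<phi> unit_disk" "\<phi> ` unit_disk \<subseteq> unit_disk"
    and \<phi>_r: "\<And>z. z \<in> unit_disk \<Longrightarrow> r < cmod (\<phi> z)"
    and \<phi>_S: "\<And>z. z \<in> unit_disk \<Longrightarrow> cmod (schwarzian \<phi> z) * (1 - (cmod z)\<^sup>2)\<^sup>2 \<le> \<delta>\<^sub>0 - \<beta>"
    and \<rho>: "0 < \<rho>" "ball \<zeta> \<rho> \<inter> unit_disk \<subseteq> \<phi> ` unit_disk"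
    using boundary_chart[of "\<delta>\<^sub>0 - \<beta>" r \<zeta>] \<beta>(2) r \<zeta> by auto
  have "weighted_schwarzian_H h g (\<phi> z) \<le> \<beta>" if "z \<in> unit_disk" for z
    using small[OF \<phi>_r[OF that]] \<phi>(3) that by (force simp: image_subset_iff)
  then have "schwarzian_norm_H (\<lambda>z. h (\<phi> z)) (\<lambda>z. g (\<phi> z) - g (\<phi> 0)) \<le> ereal \<delta>\<^sub>0"
    using schwarzian_norm_H_compose_le[OF assms(4) \<phi> _ \<phi>_S, of \<beta>] by simp
  then have "inj_on (\<lambda>z. f (\<phi> z) - cnj (g (\<phi> 0))) unit_disk"
    by (rule assms(2)[OF orientation_preserving_harmonic_compose[OF assms(4) \<phi>]])
  then have "inj_on f (\<phi> ` unit_disk)"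
    by (auto simp: inj_on_def)
  then show "\<exists>\<rho>>0. inj_on f (ball \<zeta> \<rho> \<inter> unit_disk)"
    using \<rho> inj_on_subset by blast
qed

end
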